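(* Let $A_n\in\mathbb{Z}[z,\bar z]$ be the polynomials giving the folding maps for the Lie algebra $\mathcal{A}_2$, defined by $A_0=3$, $A_1=z$, $A_2=z^2-2\bar z$ and $A_n=zA_{n-1}-\bar zA_{n-2}+A_{n-3}$ for $n\ge3$. Then for all $n\ge2$, the polynomial $A_n\in\mathbb{Z}[z,\bar z]$ satisfies $$A_n(z)=z^n-nz^{n-2}\bar z+\frac{n^2-3n}{2}z^{n-4}\bar z^2+O(n-3).$$
   Context: Here $z=x+iy$ and $\bar z=x-iy$, where $x,y$ are the coordinates on the affine plane. The notation $O(d)$ stands for a polynomial in $z,\bar z$ of total degree at most $d$, i.e. $f=g+O(d)$ means that $f-g$ has the form $\sum_{i+j\le d}a_{ij}z^i\bar z^j$. For $n=3$ the formula appears to have a term of the form $z^{-1}\bar z^2$, but the coefficient $\frac{n^2-3n}{2}$ vanishes, so that term does not appear.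
   Formalization: For n=2 the third term, −z^{−2}z̄², is not a polynomial and the formula fails literally, since A_2=z²−2z̄ and O(−1)=0; the formal statement drops that term at n=2 and keeps the formula unchanged for all n≥3. *)

theory Defs
  imports "HOL-Computational_Algebra.Polynomial"
begin

text \<open>
  The ring \<open>\<int>[z, zbar]\<close> is modelled as \<^typ>\<open>int poly poly\<close>: as \<open>x, y\<close> are the coordinates of the
  affine plane, \<open>z = x + iy\<close> and \<open>zbar = x - iy\<close> are algebraically independent.  The inner
  indeterminate is \<open>z\<close>, the outer one is \<open>zbar\<close>.
\<close>

definition Z :: "int poly poly" where
  "Z = [:[:0, 1:]:]"

definition Zbar :: "int poly poly" where
  "Zbar = [:0, 1:]"

fun A :: "nat \<Rightarrow> int poly poly" where
  "A 0 = 3"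
| "A (Suc 0) = Z"
| "A (Suc (Suc 0)) = Z ^ 2 - 2 * Zbar"
| "A (Suc (Suc (Suc n))) = Z * A (Suc (Suc n)) - Zbar * A (Suc n) + A n"

text \<open>
  \<open>eq_mod_O d f g\<close> is \<open>f = g + O(d)\<close>.  The bound is an integer: for negative \<open>d\<close> the sum is
  empty, so the relation is equality.
\<close>

definition eq_mod_O :: "int \<Rightarrow> int poly poly \<Rightarrow> int poly poly \<Rightarrow> bool" where
  "eq_mod_O d f g \<longleftrightarrow>
     (\<exists>a :: nat \<Rightarrow> nat \<Rightarrow> int.
        f - g = (\<Sum>(i, j) \<in> {(i, j). int i + int j \<le> d}. of_int (a i j) * Z ^ i * Zbar ^ j))"

end

theory Submission
  imports Defs
begin

(* Subtracting the claimed leading terms P n from A n leaves remainders R n that satisfy the same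
   recursion up to terms of low degree: for n >= 3,
   R (n + 3) = Z * R (n + 2) - Zbar * R (n + 1) + A n - c (n + 1) * Z ^ (n - 3) * Zbar ^ 3,
   where c k = (k^2 - 3 * k) / 2 satisfies c (k + 1) = c k + (k - 1).  The last two terms have
   degree at most n, so the degree bound propagates. *)

text \<open>A coefficientwise form of the O-bound: unlike the existential over sums, it passes
  through sums and products by plain simplification. The outer index \<open>j\<close> is the
  exponent of \<open>Zbar\<close>; a negative \<open>d\<close> forces \<open>f = 0\<close>.\<close>

definition total_degree_le :: "int \<Rightarrow> int poly poly \<Rightarrow> bool" where
  "total_degree_le d f \<longleftrightarrow> (\<forall>i j. d < int i + int j \<longrightarrow> coeff (coeff f j) i = 0)"

lemma monomial_eq_monom: "of_int c * Z ^ i * Zbar ^ j = monom (monom c i) j"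
proof -
  have "of_int c = [:[:c:]:]" by (simp add: of_int_poly)
  moreover have "Z ^ i = [:monom 1 i:]"
    by (induction i) (simp_all add: Z_def monom_0 monom_Suc one_pCons)
  moreover have "Zbar ^ j = monom 1 j"
    by (induction j) (simp_all add: Zbar_def monom_0 monom_Suc smult_monom flip: one_pCons)
  ultimately show ?thesis by (simp add: smult_monom)
qed

lemma finite_total_degree_le: "finite {(i, j). int i + int j \<le> d}"
  by (rule finite_subset[of _ "{..nat d} \<times> {..nat d}"]) auto

lemma eq_mod_O_if_total_degree_le:
  assumes "total_degree_le d (f - g)"
  shows "eq_mod_O d f g"
  unfolding eq_mod_O_def
proof (intro exI poly_eqI)
  fix k l
  \<comment> \<open>The witness is the coefficient family of \<open>f - g\<close> itself. The sum
    collapses to the term at \<open>(l, k)\<close>; outside \<open>?S\<close> that coefficient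
    vanishes by assumption.\<close>
  let ?S = "{(i, j). int i + int j \<le> d}" and ?a = "\<lambda>i j. coeff (coeff (f - g) j) i"
  have "coeff (coeff (\<Sum>(i, j) \<in> ?S. of_int (?a i j) * Z ^ i * Zbar ^ j) k) l
      = (\<Sum>p \<in> ?S. if p = (l, k) then ?a l k else 0)"
    unfolding coeff_sum monomial_eq_monom
    by (rule sum.cong) (auto simp del: coeff_diff split: if_splits)
  also have "\<dots> = (if (l, k) \<in> ?S then ?a l k else 0)"
    by (rule sum.delta[OF finite_total_degree_le])
  also have "\<dots> = ?a l k"
    using assms by (auto simp: total_degree_le_def)
  finally show "coeff (coeff (f - g) k) l
      = coeff (coeff (\<Sum>(i, j) \<in> ?S. of_int (?a i j) * Z ^ i * Zbar ^ j) k) l" ..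
qed

lemma total_degree_le_monomial:
  "int i + int j \<le> d \<Longrightarrow> total_degree_le d (of_int c * Z ^ i * Zbar ^ j)"
  unfolding monomial_eq_monom by (auto simp: total_degree_le_def)

lemma total_degree_le_mono: "total_degree_le d f \<Longrightarrow> d \<le> e \<Longrightarrow> total_degree_le e f"
  by (simp add: total_degree_le_def)

lemma total_degree_le_add:
  "total_degree_le d f \<Longrightarrow> total_degree_le d g \<Longrightarrow> total_degree_le d (f + g)"
  by (simp add: total_degree_le_def)

lemma total_degree_le_diff:
  "total_degree_le d f \<Longrightarrow> total_degree_le d g \<Longrightarrow> total_degree_le d (f - g)"
  by (simp add: total_degree_le_def)

lemma total_degree_le_Z_mult: "total_degree_le d f \<Longrightarrow> total_degree_le (d + 1) (Z * f)"
  by (auto simp: total_degree_le_def Z_def coeff_pCons split: nat.split)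

lemma total_degree_le_Zbar_mult: "total_degree_le d f \<Longrightarrow> total_degree_le (d + 1) (Zbar * f)"
  by (auto simp: total_degree_le_def Zbar_def coeff_pCons split: nat.split)

lemma total_degree_le_A: "total_degree_le (int n) (A n)"
proof (induction n rule: A.induct)
  case 1
  show ?case using total_degree_le_monomial[of 0 0 0 3] by simp
next
  case 2
  show ?case using total_degree_le_monomial[of 1 0 1 1] by simp
next
  case 3
  show ?case
    using total_degree_le_diff[OF total_degree_le_monomial[of 2 0 2 1]
        total_degree_le_monomial[of 0 1 2 2]]
    by simp
next
  case (4 n)
  have "total_degree_le (int n + 3) (Z * A (Suc (Suc n)))"
    by (rule total_degree_le_mono[OF total_degree_le_Z_mult[OF 4(1)]]) simp
  moreover have "total_degree_le (int n + 3) (Zbar * A (Suc n))"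
    by (rule total_degree_le_mono[OF total_degree_le_Zbar_mult[OF 4(2)]]) simp
  moreover have "total_degree_le (int n + 3) (A n)"
    by (rule total_degree_le_mono[OF 4(3)]) simp
  ultimately show ?case
    by (simp add: total_degree_le_add total_degree_le_diff add.commute)
qed

definition third_coeff :: "nat \<Rightarrow> int" where
  "third_coeff n = ((int n)\<^sup>2 - 3 * int n) div 2"

text \<open>The dividend grows by the even number 2 (n - 1), so \<open>div\<close> shifts by exactly
  n - 1.\<close>

lemma third_coeff_Suc: "third_coeff (Suc n) = third_coeff n + (int n - 1)"
proof -
  have "(int (Suc n))\<^sup>2 - 3 * int (Suc n) = ((int n)\<^sup>2 - 3 * int n) + (int n - 1) * 2"
    by (simp add: power2_eq_square algebra_simps)
  then show ?thesis
    unfolding third_coeff_def by (simp only: div_mult_self1)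
qed

definition leading_terms :: "nat \<Rightarrow> int poly poly" where
  "leading_terms n = Z ^ n - of_nat n * Z ^ (n - 2) * Zbar
     + (if n = 2 then 0 else of_int (third_coeff n) * Z ^ (n - 4) * Zbar ^ 2)"

text \<open>The \<open>Zbar ^ 2\<close> terms match because the second term of
  \<open>leading_terms (k + 4)\<close> contributes k + 4, the increment of
  \<open>third_coeff\<close> from k + 5 to k + 6. Its third term has no counterpart on the left and
  is cancelled by the added monomial. Starting at index 6 keeps every subtraction in the exponents
  exact.\<close>

lemma leading_terms_recursion:
  "leading_terms (k + 6) = Z * leading_terms (k + 5) - Zbar * leading_terms (k + 4)
     + of_int (third_coeff (k + 4)) * Z ^ k * Zbar ^ 3"
proof -
  have "third_coeff (k + 5) = third_coeff (k + 4) + int k + 3"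
    "third_coeff (k + 6) = third_coeff (k + 4) + 2 * int k + 7"
    using third_coeff_Suc[of "k + 4"] third_coeff_Suc[of "k + 5"]
    by (simp_all add: eval_nat_numeral)
  \<comment> \<open>All powers are reduced to the common factor \<open>Z ^ k\<close>, leaving a ring
    identity.\<close>
  moreover have "Z ^ (k + 6) = Z ^ k * Z ^ 6" "Z ^ (k + 5) = Z ^ k * Z ^ 5"
    "Z ^ (k + 4) = Z ^ k * Z ^ 4" "Z ^ (k + 3) = Z ^ k * Z ^ 3"
    "Z ^ (k + 2) = Z ^ k * Z ^ 2" "Z ^ (k + 1) = Z ^ k * Z"
    by (simp_all add: power_add power2_eq_square)
  moreover have "k + 6 - 2 = k + 4" "k + 5 - 2 = k + 3" "k + 4 - 2 = k + 2"
    "k + 6 - 4 = k + 2" "k + 5 - 4 = k + 1" "k + 4 - 4 = k" "k + 6 \<noteq> 2" "k + 5 \<noteq> 2" "k + 4 \<noteq> 2"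
    by simp_all
  ultimately show ?thesis
    unfolding leading_terms_def
    by (simp only: if_False of_int_add of_int_mult of_int_of_nat_eq of_int_numeral of_nat_add
        of_nat_numeral) (simp add: algebra_simps eval_nat_numeral)
qed

lemma total_degree_le_remainder:
  "n \<ge> 2 \<Longrightarrow> total_degree_le (int n - 3) (A n - leading_terms n)"
proof (induction n rule: less_induct)
  case (less n)
  \<comment> \<open>\<open>leading_terms_recursion\<close> covers indices from 6 on, so the first
    four are computed directly.\<close>
  consider "n = 2" | "n = 3" | "n = 4" | "n = 5" | k where "n = k + 6"
  proof -
    have "n = 2 \<or> n = 3 \<or> n = 4 \<or> n = 5 \<or> n = (n - 6) + 6"
      using less.prems by linarith
    then show thesis using that by blast
  qed
  then show ?case
  proof cases
    case 1
    \<comment> \<open>The bound is -1, so the difference must be zero.\<close>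
    then show ?thesis
      by (simp add: leading_terms_def total_degree_le_def numeral_2_eq_2)
  next
    case 2
    have "A 3 - leading_terms 3 = of_int 3 * Z ^ 0 * Zbar ^ 0"
      by (simp add: leading_terms_def third_coeff_def eval_nat_numeral algebra_simps)
    then show ?thesis using 2 total_degree_le_monomial[of 0 0 0 3] by simp
  next
    case 3
    have "A 4 - leading_terms 4 = of_int 4 * Z ^ 1 * Zbar ^ 0"
      by (simp add: leading_terms_def third_coeff_def eval_nat_numeral algebra_simps)
    then show ?thesis using 3 total_degree_le_monomial[of 1 0 1 4] by simp
  next
    case 4
    have "A 5 - leading_terms 5 = of_int 5 * Z ^ 2 * Zbar ^ 0 - of_int 5 * Z ^ 0 * Zbar ^ 1"
      by (simp add: leading_terms_def third_coeff_def eval_nat_numeral algebra_simps)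
    then show ?thesis
      using 4 total_degree_le_diff[OF total_degree_le_monomial[of 2 0 2 5]
          total_degree_le_monomial[of 0 1 2 5]] by simp
  next
    case (5 k)
    let ?R = "\<lambda>n. A n - leading_terms n" and ?d = "int k + 3"
    have "A (k + 6) = Z * A (k + 5) - Zbar * A (k + 4) + A (k + 3)"
      using A.simps(4)[of "k + 3"] by (simp add: eval_nat_numeral)
    then have "?R n = Z * ?R (k + 5) - Zbar * ?R (k + 4) + A (k + 3)
        - of_int (third_coeff (k + 4)) * Z ^ k * Zbar ^ 3"
      unfolding 5 leading_terms_recursion by (simp add: algebra_simps)
    moreover have "total_degree_le ?d (Z * ?R (k + 5))"
      by (rule total_degree_le_mono[OF total_degree_le_Z_mult[OF less.IH]]) (simp_all add: 5)
    moreover have "total_degree_le ?d (Zbar * ?R (k + 4))"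
      by (rule total_degree_le_mono[OF total_degree_le_Zbar_mult[OF less.IH]]) (simp_all add: 5)
    \<comment> \<open>This term and the next one have degree exactly k + 3 = n - 3, which is where
      the error bound comes from.\<close>
    moreover have "total_degree_le ?d (A (k + 3))"
      using total_degree_le_A[of "k + 3"] by (simp add: add.commute)
    moreover have "total_degree_le ?d (of_int (third_coeff (k + 4)) * Z ^ k * Zbar ^ 3)"
      by (rule total_degree_le_monomial) simp
    ultimately have "total_degree_le ?d (?R n)"
      by (simp only: total_degree_le_add total_degree_le_diff)
    then show ?thesis by (simp add: 5 add.commute)
  qed
qed


(* For n = 2 the formal third term - z^(-2) zbar^2 is not a polynomial and is dropped; it has to
   be, since A 2 = z^2 - 2 zbar and O(-1) = 0.  For n = 3 its coefficient is 0, so the truncated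
   exponent n - 4 is harmless. *)

theorem proposition2p5:
  fixes n :: nat
  assumes "n \<ge> 2"
  shows "eq_mod_O (int n - 3) (A n)
           (Z ^ n - of_nat n * Z ^ (n - 2) * Zbar
            + (if n = 2 then 0
               else of_int (((int n)\<^sup>2 - 3 * int n) div 2) * Z ^ (n - 4) * Zbar ^ 2))"
  using eq_mod_O_if_total_degree_le[OF total_degree_le_remainder[OF assms]]
  by (simp only: leading_terms_def third_coeff_def)

end
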